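(* For every integer $n\ge0$ let $$P_n=P_n(q)=\sum_{i\ge0}\sum_{j\ge0}\sum_{k\ge0}q^{j(j+3)/2+i^2+k}\begin{bmatrix} j\\ i\end{bmatrix}_{q^2}\begin{bmatrix} j+k\\ k\end{bmatrix}_{q^2}\begin{bmatrix} n-2i-2k\\ j\end{bmatrix}_{q}.$$ Then $$P_n=\sum_{j=-\infty}^\infty(-1)^jq^{4j^2+3j}\,V(n+2,4j+2;\sqrt q),$$ and $P_0=1$, $P_1=q^2+1$, $P_2=q^5+q^3+q^2+q+1$, and $P_n=(1+q^{n+1})P_{n-1}+qP_{n-2}+(q^n-q)P_{n-3}$ for $n\ge3$.
   Context: $q$ is an indeterminate with a formal square root $\sqrt q$. $(a;p)_n=\prod_{i=0}^{n-1}(1-ap^i)$. The Gaussian polynomial in base $p$ is $\begin{bmatrix} A\\ B\end{bmatrix}_{p}=\frac{(p;p)_A}{(p;p)_B(p;p)_{A-B}}$ if $0\le B\le A$, and $0$ otherwise. For integers $L\ge0$ and $A$, $$T_0(L,A;q)=\sum_{r=0}^L(-1)^r\begin{bmatrix} L\\ r\end{bmatrix}_{q^2}\begin{bmatrix} 2L-2r\\ L-A-r\end{bmatrix}_{q},\qquad T_1(L,A;q)=\sum_{r=0}^L(-q)^r\begin{bmatrix} L\\ r\end{bmatrix}_{q^2}\begin{bmatrix} 2L-2r\\ L-A-r\end{bmatrix}_{q},$$ and for $L\ge1$, $V(L,A;q)=T_1(L-1,A;q)+q^{L-A}\,T_0(L-1,A-1;q)$; $V(L,A;\sqrt q)$ is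 obtained by replacing $q$ by $\sqrt q$. All sums have only finitely many nonzero terms. *)

theory Defs
  imports
    "HOL-Computational_Algebra.Fraction_Field"
    "HOL-Computational_Algebra.Polynomial"
    "HOL-Library.Groups_Big_Fun"
begin

definition qpoch :: "'a::field \<Rightarrow> 'a \<Rightarrow> nat \<Rightarrow> 'a" where
  "qpoch a p n = (\<Prod>i<n. 1 - a * p ^ i)"

definition gauss :: "'a::field \<Rightarrow> int \<Rightarrow> int \<Rightarrow> 'a" where
  "gauss p A B =
    (if 0 \<le> B \<and> B \<le> A
     then qpoch p p (nat A) / (qpoch p p (nat B) * qpoch p p (nat (A - B)))
     else 0)"

definition T0 :: "nat \<Rightarrow> int \<Rightarrow> 'a::field \<Rightarrow> 'a" where
  "T0 L A q = (\<Sum>r = 0..L. (- 1) ^ r * gauss (q ^ 2) (int L) (int r) *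
     gauss q (2 * int L - 2 * int r) (int L - A - int r))"

definition T1 :: "nat \<Rightarrow> int \<Rightarrow> 'a::field \<Rightarrow> 'a" where
  "T1 L A q = (\<Sum>r = 0..L. (- q) ^ r * gauss (q ^ 2) (int L) (int r) *
     gauss q (2 * int L - 2 * int r) (int L - A - int r))"

(* Only meaningful for L >= 1, because of the truncated subtraction L - 1. The exponent L - A
   may be negative, but the T0 factor then vanishes. *)
definition V :: "nat \<Rightarrow> int \<Rightarrow> 'a::field \<Rightarrow> 'a" where
  "V L A q = T1 (L - 1) A q + q powi (int L - A) * T0 (L - 1) (A - 1) q"

definition Pterm :: "'a::field \<Rightarrow> nat \<Rightarrow> nat \<Rightarrow> nat \<Rightarrow> nat \<Rightarrow> 'a" where
  "Pterm q n i j k =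
     q ^ (j * (j + 3) div 2 + i ^ 2 + k) *
     gauss (q ^ 2) (int j) (int i) * gauss (q ^ 2) (int j + int k) (int k) *
     gauss q (int n - 2 * int i - 2 * int k) (int j)"

(* Sum_any sums over all elements with a nonzero summand; it is 0 by convention if there are
   infinitely many of those, which is excluded by Psum_eq_finite_sum and finite_support_V. *)
definition Psum :: "'a::field \<Rightarrow> nat \<Rightarrow> 'a" where
  "Psum q n = Sum_any (\<lambda>i. Sum_any (\<lambda>j. Sum_any (\<lambda>k. Pterm q n i j k)))"

lemma Pterm_nonzero_bounds:
  assumes "Pterm q n i j k \<noteq> 0"
  shows "i \<le> n" "j \<le> n" "k \<le> n"
  using assms by (auto simp: Pterm_def gauss_def split: if_splits)

lemma Psum_eq_finite_sum:
  "Psum q n = (\<Sum>i\<le>n. \<Sum>j\<le>n. \<Sum>k\<le>n. Pterm q n i j k)"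
proof -
  have k: "Sum_any (\<lambda>k. Pterm q n i j k) = (\<Sum>k\<le>n. Pterm q n i j k)" for i j
    by (rule Sum_any.expand_superset) (auto dest: Pterm_nonzero_bounds)
  have j: "Sum_any (\<lambda>j. \<Sum>k\<le>n. Pterm q n i j k) = (\<Sum>j\<le>n. \<Sum>k\<le>n. Pterm q n i j k)" for i
    by (rule Sum_any.expand_superset)
      (auto elim!: sum.not_neutral_contains_not_neutral dest: Pterm_nonzero_bounds)
  show ?thesis
    unfolding Psum_def k j
    by (rule Sum_any.expand_superset)
      (auto elim!: sum.not_neutral_contains_not_neutral dest: Pterm_nonzero_bounds)
qed

lemma T_eq_0:
  assumes "\<bar>A\<bar> > int L"
  shows "T0 L A q = 0" "T1 L A q = 0"
  unfolding T0_def T1_def using assms by (auto intro!: sum.neutral simp: gauss_def)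

lemma finite_support_V:
  "finite {j::int. f j * V L (4 * j + 2) q \<noteq> 0}"
proof (rule finite_subset)
  show "{j::int. f j * V L (4 * j + 2) q \<noteq> 0} \<subseteq> {- int L - 2..int L + 2}"
  proof (intro subsetI, rule ccontr)
    fix j assume j: "j \<in> {j::int. f j * V L (4 * j + 2) q \<noteq> 0}"
      and "j \<notin> {- int L - 2..int L + 2}"
    then have "\<bar>4 * j + 2\<bar> > int (L - 1)" "\<bar>4 * j + 2 - 1\<bar> > int (L - 1)" by auto
    then have "V L (4 * j + 2) q = 0" by (simp only: V_def T_eq_0) simp
    then show False using j by simp
  qed
qed simp

(* The indeterminate of the field of rational functions Q(x), with q = x^2 and so x = sqrt q. *)
definition sqrt_q :: "rat poly fract" where
  "sqrt_q = Fraction_Field.Fract [:0, 1:] 1"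

definition ind_q :: "rat poly fract" where
  "ind_q = sqrt_q ^ 2"

end

theory Submission
  imports Defs "HOL-Computational_Algebra.Formal_Power_Series"
begin

text \<open>
Both sides of the identity satisfy one recurrence with the same initial values, so the
recurrence itself proves the identity.

On the side of the triple sum, collect the terms with a fixed \<open>j\<close> into the generating function
over \<open>n\<close>. The three inner sums are the finite \<open>q\<close>-binomial theorem and two cases of its reciprocal
form, so that this generating function is
\<open>G_j(x) = q^{j(j+3)/2} x^j (\<Prod>_{l<j} (1 + q^{2l+1} x^2)) / (\<Prod>_{l\<le>j} (1 - q^l x) (1 - q^{2l+1} x^2))\<close>.
Hence \<open>(1 - x)(1 - q x^2) G_{j+1}(x) = q^2 x (1 + q x^2) G_j(q x)\<close> (\<open>P_fps_Suc\<close>), and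
\<open>(1 - x)(1 - q x^2) G_0(x) = 1\<close>. Summing over \<open>j\<close> and comparing coefficients gives the recurrence
(\<open>Psum_recurrence\<close>). Each of the three factors is represented by its coefficients, and its functional
equation is then the \<open>q\<close>-Pascal rule.

On the other side put \<open>s = sqrt q\<close>. The \<open>q\<close>-Pascal rule merges the two parts of \<open>V\<close> into
\<open>V(N+1, A; s) = \<Sum>_r (-s)^r [N, r]_{s^2} [2m+1, m+1-A]_s\<close> with \<open>m = N - r\<close>
(\<open>V_eq_qtrans_row\<close>), where \<open>[A, B]_p\<close> is the Gaussian polynomial in base \<open>p\<close>.
Multiplied by \<open>s^{A(A-1)/2}\<close>, the row number \<open>2m+1\<close> of Gaussian polynomials consists of the
coefficients of \<open>(1 + y) \<Prod>_{i=1}^{m} (1 + z s^i + s^{2i})\<close> in \<open>y\<close>, where \<open>z = y + 1/y\<close> (\<open>row_Suc\<close>).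
The bilateral sum of the theorem picks the coefficients with \<open>A = 4j+2\<close> with sign \<open>(-1)^j\<close>, that
is, it takes a coefficient modulo \<open>y^4 + 1\<close>. There \<open>z^2 = y^2 + 2 + y^{-2} = 2\<close>, so multiplication
by \<open>z\<close> only couples two sequences \<open>b\<close> and \<open>a\<close>, by \<open>b \<mapsto> a \<mapsto> 2 b\<close>. The transform
\<open>\<Sum>_r (-s)^r [N, r]_{s^2} f (N - r)\<close> carries the first-order relations between \<open>b\<close> and \<open>a\<close> to
a four-term recurrence for the transform of \<open>b\<close> (\<open>qtrans_recurrence\<close>), and because \<open>z^2 = 2\<close> this
recurrence is the one of the triple sum.
\<close>

unbundle fps_syntax

section \<open>Gaussian polynomials\<close>

text \<open>These are the bases for which no denominator \<open>(p; p)_n\<close> vanishes, so that the Gaussian polynomials,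
although defined as quotients, satisfy the \<open>q\<close>-Pascal rules.\<close>

definition generic :: "'a::field \<Rightarrow> bool" where
  "generic p \<longleftrightarrow> p \<noteq> 0 \<and> (\<forall>n>0. p ^ n \<noteq> 1)"

lemma genericD:
  assumes "generic p"
  shows "p \<noteq> 0" "\<And>n. n > 0 \<Longrightarrow> p ^ n \<noteq> 1"
  using assms by (auto simp: generic_def)

lemma generic_power2: "generic p \<Longrightarrow> generic (p ^ 2)"
  by (auto simp: generic_def simp flip: power_mult)

lemma qpoch_Suc: "qpoch p p (Suc n) = qpoch p p n * (1 - p ^ Suc n)"
  by (simp add: qpoch_def)

lemma qpoch_nonzero: "generic p \<Longrightarrow> qpoch p p n \<noteq> 0"
proof (induction n)
  case (Suc n)
  then show ?case
    using genericD(2)[of p "Suc n"] by (simp add: qpoch_Suc del: power_Suc)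
qed (simp add: qpoch_def)

lemma gauss_add: "gauss p (int (b + c)) (int b) = qpoch p p (b + c) / (qpoch p p b * qpoch p p c)"
  by (simp add: gauss_def nat_add_distrib)

lemma gauss_eq_0: "B < 0 \<or> A < B \<Longrightarrow> gauss p A B = 0"
  by (auto simp: gauss_def)

lemma gauss_0: "generic p \<Longrightarrow> A \<ge> 0 \<Longrightarrow> gauss p A 0 = 1"
  by (simp add: gauss_def qpoch_nonzero) (simp add: qpoch_def)

lemma gauss_symmetric: "gauss p A (A - B) = gauss p A B"
  by (auto simp: gauss_def mult.commute)

lemma gauss_self: "generic p \<Longrightarrow> A \<ge> 0 \<Longrightarrow> gauss p A A = 1"
  using gauss_symmetric[of p A 0] by (simp add: gauss_0)

lemma gauss_Pascal:
  assumes p: "generic p" and A: "A \<ge> 0"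
  shows "gauss p (A + 1) B = gauss p A (B - 1) + p powi B * gauss p A B"
proof -
  consider "B < 0" | "B = 0" | "B = A + 1" | "B > A + 1" | "1 \<le> B" "B \<le> A" by linarith
  then show ?thesis
  proof cases
    case 5
    define b where "b = nat (B - 1)"
    define c where "c = nat (A - B)"
    have B: "B = int (Suc b)" and AA: "A = int (b + Suc c)" using 5 by (auto simp: b_def c_def)
    have 1: "A = int (Suc b + c)" "A + 1 = int (Suc b + Suc c)" "B - 1 = int b" using AA B by auto
    define W where "W = qpoch p p (Suc (b + c))"
    define x where "x = p ^ Suc b"
    define y where "y = p ^ Suc c"
    have xy: "p ^ Suc (Suc (b + c)) = x * y" unfolding x_def y_def by (simp add: power_add)
    have "gauss p (A + 1) B = qpoch p p (Suc b + Suc c) / (qpoch p p (Suc b) * qpoch p p (Suc c))"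
      unfolding 1(2) unfolding B by (rule gauss_add)
    also have "\<dots> = W * (1 - x * y) / (qpoch p p b * (1 - x) * (qpoch p p c * (1 - y)))"
      by (simp only: qpoch_Suc xy x_def y_def W_def add_Suc add_Suc_right)
    finally have g1: "gauss p (A + 1) B = \<dots>" .
    have "gauss p A (B - 1) = qpoch p p (b + Suc c) / (qpoch p p b * qpoch p p (Suc c))"
      unfolding 1(3) unfolding AA by (rule gauss_add)
    also have "\<dots> = W / (qpoch p p b * (qpoch p p c * (1 - y)))"
      by (simp only: qpoch_Suc y_def W_def add_Suc_right)
    finally have g2: "gauss p A (B - 1) = \<dots>" .
    have "gauss p A B = qpoch p p (Suc b + c) / (qpoch p p (Suc b) * qpoch p p c)"
      unfolding 1(1) unfolding B by (rule gauss_add)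
    also have "\<dots> = W / (qpoch p p b * (1 - x) * qpoch p p c)"
      by (simp only: qpoch_Suc x_def W_def add_Suc)
    finally have g3: "gauss p A B = \<dots>" .
    have B': "p powi B = x" unfolding B x_def by (rule power_int_of_nat)
    have "1 - x \<noteq> 0" "1 - y \<noteq> 0" using genericD(2)[OF p] by (auto simp: x_def y_def simp del: power_Suc)
    then show ?thesis
      using qpoch_nonzero[OF p, of b] qpoch_nonzero[OF p, of c]
      unfolding g1 g2 g3 B' by (simp add: divide_simps) (simp add: algebra_simps)
  qed (use A p in \<open>simp_all add: gauss_eq_0 gauss_0 gauss_self\<close>)
qed

lemma gauss_Pascal':
  assumes "generic p" "A \<ge> 0"
  shows "gauss p (A + 1) B = gauss p A B + p powi (A + 1 - B) * gauss p A (B - 1)"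
  using gauss_Pascal[OF assms, of "A + 1 - B"] gauss_symmetric[of p "A + 1" B]
    gauss_symmetric[of p A B] gauss_symmetric[of p A "B - 1"]
  by (simp add: algebra_simps)

lemma gauss_absorb:
  assumes p: "generic p" 
  shows "(1 - p ^ Suc r) * gauss p (int (Suc n)) (int (Suc r)) = (1 - p ^ Suc n) * gauss p (int n) (int r)"
proof (cases "r \<le> n")
  case True
  then obtain c where n: "n = r + c" using le_Suc_ex by blast
  have 1: "gauss p (int (Suc n)) (int (Suc r)) = qpoch p p (Suc r + c) / (qpoch p p (Suc r) * qpoch p p c)"
    using gauss_add[of p "Suc r" c] by (simp add: n)
  have 2: "gauss p (int n) (int r) = qpoch p p (r + c) / (qpoch p p r * qpoch p p c)"
    unfolding n by (rule gauss_add)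
  have "1 - p ^ Suc r \<noteq> 0" using genericD(2)[OF p] by (auto simp del: power_Suc)
  then show ?thesis
    unfolding 1 2 using qpoch_nonzero[OF p, of r] qpoch_nonzero[OF p, of c]
    by (simp add: n qpoch_Suc field_simps del: power_Suc)
qed (simp add: gauss_eq_0)

text \<open>One step with each of the two Pascal rules gives a formula that is symmetric under
\<open>B \<mapsto> A + 2 - B\<close>, as multiplication by a polynomial in \<open>y + 1/y\<close> requires; see \<open>row_Suc\<close>.\<close>

lemma gauss_Pascal_twice:
  assumes p: "generic p" and A: "A \<ge> 0"
  shows "gauss p (A + 2) B = (1 + p powi (A + 1)) * gauss p A (B - 1) + p powi B * gauss p A B
     + p powi (A + 2 - B) * gauss p A (B - 2)"
proof -
  have "gauss p (A + 2) B = gauss p (A + 1) (B - 1) + p powi B * gauss p (A + 1) B"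
    using gauss_Pascal[OF p, of "A + 1" B] A by (simp add: add.commute)
  moreover have "gauss p (A + 1) (B - 1) = gauss p A (B - 1) + p powi (A + 2 - B) * gauss p A (B - 2)"
    using gauss_Pascal'[OF assms, of "B - 1"] by (simp add: algebra_simps)
  moreover have "gauss p (A + 1) B = gauss p A B + p powi (A + 1 - B) * gauss p A (B - 1)"
    by (rule gauss_Pascal'[OF assms])
  moreover have "p powi (A + 1) = p powi B * p powi (A + 1 - B)"
    using genericD(1)[OF p] by (simp flip: power_int_add)
  ultimately show ?thesis by (simp add: algebra_simps)
qed

section \<open>A binomial transform and its recurrence\<close>

text \<open>The sum over \<open>r\<close> in \<open>V\<close>, as an operator on sequences.\<close>

definition qtrans :: "'a::field \<Rightarrow> (nat \<Rightarrow> 'a) \<Rightarrow> nat \<Rightarrow> 'a" where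
  "qtrans s f N = (\<Sum>r\<le>N. (- s) ^ r * gauss (s ^ 2) (int N) (int r) * f (N - r))"

lemma qtrans_0: "generic s \<Longrightarrow> qtrans s f 0 = f 0"
  by (simp add: qtrans_def gauss_0[OF generic_power2])

lemma qtrans_add: "qtrans s (\<lambda>m. f m + g m) N = qtrans s f N + qtrans s g N"
  by (simp add: qtrans_def algebra_simps sum.distrib)

lemma qtrans_scale: "qtrans s (\<lambda>m. c * f m) N = c * qtrans s f N"
  by (simp add: qtrans_def algebra_simps sum_distrib_left)

text \<open>The Pascal rule turns a step in \<open>N\<close> into a first-order difference operator on the sequence.\<close>

lemma qtrans_Suc:
  assumes s: "generic s"
  shows "qtrans s f (Suc N) = qtrans s (\<lambda>m. f (Suc m) - s * s ^ (2 * m) * f m) N"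
proof -
  let ?g = "\<lambda>N r. gauss (s ^ 2) (int N) r"
  have P: "?g (Suc N) B = ?g N B + (s ^ 2) powi (int N + 1 - B) * ?g N (B - 1)" for B
    using gauss_Pascal'[OF generic_power2[OF s], of "int N" B] by (simp add: add.commute)
  have "qtrans s f (Suc N) = (\<Sum>r\<le>Suc N. (- s) ^ r * ?g N (int r) * f (Suc N - r))
      + (\<Sum>r\<le>Suc N. (- s) ^ r * ((s ^ 2) powi (int N + 1 - int r) * ?g N (int r - 1)) * f (Suc N - r))"
    unfolding qtrans_def P by (simp only: ring_distribs sum.distrib)
  also have "(\<Sum>r\<le>Suc N. (- s) ^ r * ?g N (int r) * f (Suc N - r))
      = (\<Sum>r\<le>N. (- s) ^ r * ?g N (int r) * f (Suc (N - r)))"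
    by (simp add: gauss_eq_0 Suc_diff_le)
  also have "(\<Sum>r\<le>Suc N. (- s) ^ r * ((s ^ 2) powi (int N + 1 - int r) * ?g N (int r - 1)) * f (Suc N - r))
      = (\<Sum>r\<le>N. (- s) ^ Suc r * ((s ^ 2) powi (int N - int r) * ?g N (int r)) * f (N - r))"
    by (subst sum.atMost_Suc_shift) (simp add: gauss_eq_0)
  also have "\<dots> = (\<Sum>r\<le>N. (- s) ^ Suc r * (s ^ (2 * (N - r)) * ?g N (int r)) * f (N - r))"
  proof (intro sum.cong refl)
    fix r assume "r \<in> {..N}"
    then have "int N - int r = int (N - r)" by auto
    then have "(s ^ 2) powi (int N - int r) = s ^ (2 * (N - r))"
      by (simp only: power_int_of_nat power_mult)
    then show "(- s) ^ Suc r * ((s ^ 2) powi (int N - int r) * ?g N (int r)) * f (N - r)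
       = (- s) ^ Suc r * (s ^ (2 * (N - r)) * ?g N (int r)) * f (N - r)" by simp
  qed
  finally show ?thesis
    by (simp add: qtrans_def algebra_simps flip: sum.distrib)
qed

text \<open>Division of the sequence by \<open>s^{2m}\<close> amounts to a factor \<open>s^{2r}\<close> in the sum, up to \<open>s^{2N}\<close>, and
\<open>1 - s^{2r}\<close> is absorbed into the Gaussian polynomial, which lowers \<open>N\<close>.\<close>

lemma qtrans_absorb:
  assumes s: "generic s"
  shows "qtrans s f (Suc N) = s ^ (2 * Suc N) * qtrans s (\<lambda>m. f m / s ^ (2 * m)) (Suc N)
     - s * (1 - s ^ (2 * Suc N)) * qtrans s f N"
proof -
  let ?g = "\<lambda>N r. gauss (s ^ 2) (int N) r"
  have "qtrans s f (Suc N) - s ^ (2 * Suc N) * qtrans s (\<lambda>m. f m / s ^ (2 * m)) (Suc N)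
    = (\<Sum>r\<le>Suc N. (- s) ^ r * ((1 - (s ^ 2) ^ r) * ?g (Suc N) (int r)) * f (Suc N - r))"
    unfolding qtrans_def sum_distrib_left sum_subtractf[symmetric]
  proof (intro sum.cong refl)
    fix r assume "r \<in> {..Suc N}"
    then have "s ^ (2 * Suc N) = (s ^ 2) ^ r * s ^ (2 * (Suc N - r))"
      by (simp flip: power_mult power_add add: add_mult_distrib2[symmetric] del: mult_Suc_right power_Suc)
    then show "(- s) ^ r * ?g (Suc N) (int r) * f (Suc N - r) -
         s ^ (2 * Suc N) * ((- s) ^ r * ?g (Suc N) (int r) * (f (Suc N - r) / s ^ (2 * (Suc N - r)))) =
         (- s) ^ r * ((1 - (s ^ 2) ^ r) * ?g (Suc N) (int r)) * f (Suc N - r)"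
      using genericD(1)[OF s] by (simp add: algebra_simps)
  qed
  also have "\<dots> = (\<Sum>r\<le>N. (- s) ^ Suc r * ((1 - (s ^ 2) ^ Suc N) * ?g N (int r)) * f (N - r))"
    by (subst sum.atMost_Suc_shift)
      (simp only: gauss_absorb[OF generic_power2[OF s]] power_0 diff_Suc_Suc, simp)
  also have "\<dots> = - s * (1 - s ^ (2 * Suc N)) * qtrans s f N"
  proof -
    have E: "(s ^ 2) ^ Suc N = s ^ (2 * Suc N)" by (simp only: power_mult)
    show ?thesis
      unfolding qtrans_def sum_distrib_left E
      by (intro sum.cong refl) (simp only: power_Suc[of "- s"] mult_ac)
  qed
  finally show ?thesis by (simp add: algebra_simps)
qed

text \<open>The sequence \<open>a\<close> plays the role of \<open>z b\<close>, where \<open>z^2 = 2\<close>. Write \<open>e\<close> for the transform of \<open>b\<close>. The step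
rule expresses \<open>e (N + 1) - e N\<close> by the transforms of \<open>s^m a m\<close> and of \<open>s^{2m} b m\<close>; the absorption
rule then replaces these two by \<open>e\<close> and by \<open>X N = s^{2N} qtrans s (a m / s^m) N\<close>. What results is \<open>s X\<close>
as a combination of three consecutive values of \<open>e\<close>, and \<open>X\<close> has a first-order recurrence with
inhomogeneous term \<open>2 s^{2N} e (N - 1)\<close>. Eliminating \<open>X\<close> gives the claim. For \<open>N = 0\<close> the truncated
\<open>N - 1\<close> does no harm, since its coefficient \<open>s^2 - s^2\<close> vanishes.\<close>

lemma qtrans_recurrence:
  fixes s :: "'a::field" and a b :: "nat \<Rightarrow> 'a"
  assumes s: "generic s"
    and b: "\<And>m. b (Suc m) = (1 + s ^ (2 * Suc m)) * b m + s ^ Suc m * a m"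
    and a: "\<And>m. a (Suc m) = (1 + s ^ (2 * Suc m)) * a m + 2 * s ^ Suc m * b m"
  shows "qtrans s b (N + 2) = (1 + s ^ (2 * (N + 2))) * qtrans s b (N + 1) + s ^ 2 * qtrans s b N
     + (s ^ (2 * (N + 1)) - s ^ 2) * qtrans s b (N - 1)"
proof -
  have s0: "s \<noteq> 0" using genericD(1)[OF s] .
  let ?e = "qtrans s b" and ?A = "qtrans s (\<lambda>m. s ^ m * a m)" and ?B = "qtrans s (\<lambda>m. s ^ (2 * m) * b m)"
  define X where "X N = s ^ (2 * N) * qtrans s (\<lambda>m. a m / s ^ m) N" for N
  have e: "?e (Suc N) = ?e N + s * ?A N + (s ^ 2 - s) * ?B N" for N
  proof -
    have "?e (Suc N) = qtrans s (\<lambda>m. (b m + s * (s ^ m * a m)) + (s ^ 2 - s) * (s ^ (2 * m) * b m)) N"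
      unfolding qtrans_Suc[OF s] b by (simp add: algebra_simps power2_eq_square)
    then show ?thesis by (simp only: qtrans_add qtrans_scale)
  qed
  have A: "?A (Suc N) = X (Suc N) - s * (1 - s ^ (2 * Suc N)) * ?A N" for N
  proof -
    have "s ^ m * a m / s ^ (2 * m) = a m / s ^ m" for m
      using s0 by (simp add: field_simps power_add[symmetric] mult_2[symmetric])
    then show ?thesis unfolding X_def by (subst qtrans_absorb[OF s]) simp
  qed
  have B: "?B (Suc N) = s ^ (2 * Suc N) * ?e (Suc N) - s * (1 - s ^ (2 * Suc N)) * ?B N" for N
    by (subst qtrans_absorb[OF s]) (simp add: s0)
  \<comment> \<open>The summand \<open>s ^ (2 * Suc m) * a m\<close> of \<open>a (Suc m)\<close> cancels against the second term of \<open>qtrans_Suc\<close>.\<close>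
  have X: "X (Suc N) = s * X N + 2 * s ^ (2 * Suc N) * ?e N" for N
  proof -
    have "a (Suc m) / s ^ Suc m - s * s ^ (2 * m) * (a m / s ^ m) = (1 / s) * (a m / s ^ m) + 2 * b m" for m
      unfolding a using s0 by (simp add: field_simps power_add[symmetric] mult_2[symmetric])
    then have H: "qtrans s (\<lambda>m. a m / s ^ m) (Suc N) = (1 / s) * qtrans s (\<lambda>m. a m / s ^ m) N + 2 * ?e N"
      unfolding qtrans_Suc[OF s] by (simp only: qtrans_add qtrans_scale)
    show ?thesis unfolding X_def H using s0 by (simp add: field_simps)
  qed
  \<comment> \<open>At \<open>N = 0\<close> the last summand has the factor \<open>1 - s ^ 0 = 0\<close>.\<close>
  have sX: "s * X N = ?e (N + 1) - (1 - s + s ^ (2 * Suc N)) * ?e N - s * (1 - s ^ (2 * N)) * ?e (N - 1)" for N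
  proof (cases N)
    case 0
    then show ?thesis
      using e[of 0] by (simp add: X_def qtrans_0[OF s] algebra_simps power2_eq_square)
  next
    case (Suc M)
    have "?e (Suc N) - ?e N + s * (1 - s ^ (2 * N)) * (?e N - ?e M) = s * X N + (s ^ 2 - s) * s ^ (2 * N) * ?e N"
    proof -
      have d: "?e (Suc k) - ?e k = s * ?A k + (s ^ 2 - s) * ?B k" for k
        by (simp add: e)
      show ?thesis
        unfolding Suc d A B by (simp add: algebra_simps)
    qed
    then show ?thesis by (simp add: Suc algebra_simps power2_eq_square)
  qed
  have "?e (N + 2) = s * X (Suc N) + (1 - s + s ^ (2 * (N + 2))) * ?e (N + 1)
      + s * (1 - s ^ (2 * (N + 1))) * ?e N"
    using sX[of "N + 1"] by (simp add: algebra_simps)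
  also have "s * X (Suc N) = s * (s * X N) + 2 * s * s ^ (2 * (N + 1)) * ?e N"
    unfolding X by (simp add: algebra_simps)
  finally show ?thesis
    unfolding sX by (simp add: algebra_simps power2_eq_square)
qed

section \<open>The bilateral sum\<close>

text \<open>Up to the factor \<open>s\<close>, this is the power of \<open>q = s^2\<close> in the theorem at \<open>A = 4j+2\<close>: the exponent
\<open>A(A-1)/2\<close> equals \<open>1 + 2(4j^2+3j)\<close>.\<close>

definition weight :: "'a::field \<Rightarrow> int \<Rightarrow> 'a" where
  "weight s A = s powi (A * (A - 1) div 2)"

text \<open>By the \<open>q\<close>-binomial theorem, \<open>row s m A\<close> is the coefficient of \<open>y^A\<close> in
\<open>(1 + y) \<Prod>_{i=1}^{m} (1 + s^i y) (1 + s^i / y)\<close>.\<close>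

definition row :: "'a::field \<Rightarrow> nat \<Rightarrow> int \<Rightarrow> 'a" where
  "row s m A = weight s A * gauss s (2 * int m + 1) (int m + 1 - A)"

lemma weight_add_1: "s \<noteq> 0 \<Longrightarrow> weight s (A + 1) = s powi A * weight s A"
proof -
  assume "s \<noteq> 0"
  have "(A + 1) * (A + 1 - 1) = A * (A - 1) + 2 * A" by (simp add: algebra_simps)
  then have "(A + 1) * (A + 1 - 1) div 2 = A * (A - 1) div 2 + A" by simp
  with \<open>s \<noteq> 0\<close> show ?thesis by (simp add: weight_def power_int_add)
qed

lemma row_eq_0: "A \<notin> {- int m..int m + 1} \<Longrightarrow> row s m A = 0"
  by (auto simp: row_def gauss_eq_0)

text \<open>Multiplication by \<open>(1 + s^{m+1} y) (1 + s^{m+1} / y)\<close>. The weight is chosen so that the powers of \<open>s\<close>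
that depend on \<open>A\<close> in the twofold Pascal rule disappear.\<close>

lemma row_Suc:
  assumes s: "generic s"
  shows "row s (Suc m) A = (1 + s ^ (2 * Suc m)) * row s m A
     + s ^ Suc m * (row s m (A - 1) + row s m (A + 1))"
proof -
  have s0: "s \<noteq> 0" using genericD(1)[OF s] .
  let ?g = "gauss s (2 * int m + 1)"
  have "gauss s (2 * int (Suc m) + 1) (int (Suc m) + 1 - A) = gauss s (2 * int m + 1 + 2) (int m + 2 - A)"
    by (simp add: algebra_simps)
  also have "\<dots> = (1 + s powi (2 * int m + 2)) * ?g (int m + 1 - A)
      + s powi (int m + 2 - A) * ?g (int m + 2 - A) + s powi (int m + 1 + A) * ?g (int m - A)"
    by (subst gauss_Pascal_twice[OF s]) (simp_all add: algebra_simps)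
  finally have 1: "row s (Suc m) A = weight s A * ((1 + s ^ (2 * Suc m)) * ?g (int m + 1 - A)
      + s powi (int m + 2 - A) * ?g (int m + 2 - A) + s powi (int m + 1 + A) * ?g (int m - A))"
    unfolding row_def using power_int_of_nat[of s "2 * Suc m"] by (simp add: add.commute)
  have 2: "weight s A * s powi (int m + 2 - A) = s ^ Suc m * weight s (A - 1)"
  proof -
    have "s powi int (Suc m) = s powi (A - 1) * s powi (int m + 2 - A)"
      using s0 by (simp flip: power_int_add)
    moreover have "weight s A = s powi (A - 1) * weight s (A - 1)"
      using weight_add_1[OF s0, of "A - 1"] by simp
    ultimately show ?thesis unfolding power_int_of_nat by simp
  qed
  have 3: "weight s A * s powi (int m + 1 + A) = s ^ Suc m * weight s (A + 1)"
  proof -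
    have "s powi (int m + 1 + A) = s powi int (Suc m) * s powi A"
      using s0 by (simp add: add_ac flip: power_int_add)
    then show ?thesis unfolding weight_add_1[OF s0] power_int_of_nat by simp
  qed
  have "row s (Suc m) A = (1 + s ^ (2 * Suc m)) * row s m A
     + (weight s A * s powi (int m + 2 - A)) * ?g (int m + 2 - A)
     + (weight s A * s powi (int m + 1 + A)) * ?g (int m - A)"
    unfolding 1 row_def[of s m A] by (simp add: algebra_simps)
  also have "\<dots> = (1 + s ^ (2 * Suc m)) * row s m A + s ^ Suc m * (row s m (A - 1) + row s m (A + 1))"
    unfolding 2 3 unfolding row_def by (simp add: algebra_simps)
  finally show ?thesis .
qed

text \<open>For each \<open>r\<close>, the summands of \<open>T1\<close> and of \<open>T0\<close> in \<open>V\<close> are the two terms of the Pascal rule for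
row \<open>2(N-r)+1\<close>.\<close>

lemma V_eq_qtrans_row:
  assumes s: "generic s"
  shows "weight s A * V (Suc N) A s = qtrans s (\<lambda>m. row s m A) N"
proof -
  have s0: "s \<noteq> 0" using genericD(1)[OF s] .
  have "V (Suc N) A s = (\<Sum>r\<le>N. (- s) ^ r * gauss (s ^ 2) (int N) (int r) *
      gauss s (2 * int (N - r) + 1) (int (N - r) + 1 - A))"
    unfolding V_def T0_def T1_def sum_distrib_left atLeast0AtMost diff_Suc_1 sum.distrib[symmetric]
  proof (intro sum.cong refl)
    fix r assume "r \<in> {..N}"
    then obtain M where N: "N = M + r" by (metis add.commute atMost_iff le_Suc_ex)
    then have M: "N - r = M" by simp
    have P: "gauss s (2 * int M + 1) (int M + 1 - A) =
       gauss s (2 * int M) (int M - A) + s powi (int M + 1 - A) * gauss s (2 * int M) (int M + 1 - A)"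
      using gauss_Pascal[OF s, of "2 * int M" "int M + 1 - A"] by (simp add: diff_add_eq)
    have w: "s powi (int (Suc N) - A) = s ^ r * s powi (int M + 1 - A)"
    proof -
      have "int (Suc N) - A = int r + (int M + 1 - A)" using N by simp
      then show ?thesis using s0 by (simp only: power_int_add[OF disjI1[OF s0]] power_int_of_nat)
    qed
    have m: "(- s) ^ r = (- 1) ^ r * s ^ r" by (rule power_minus)
    have 1: "2 * int N - 2 * int r = 2 * int M" "int N - A - int r = int M - A"
      "int N - (A - 1) - int r = int M + 1 - A" using N by auto
    show "(- s) ^ r * gauss (s\<^sup>2) (int N) (int r) * gauss s (2 * int N - 2 * int r) (int N - A - int r) +
         s powi (int (Suc N) - A) *
         ((- 1) ^ r * gauss (s\<^sup>2) (int N) (int r) * gauss s (2 * int N - 2 * int r) (int N - (A - 1) - int r)) =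
         (- s) ^ r * gauss (s\<^sup>2) (int N) (int r) * gauss s (2 * int (N - r) + 1) (int (N - r) + 1 - A)"
      unfolding 1 M P w m by (simp only: ring_distribs mult_ac)
  qed
  then show ?thesis
    by (simp only: qtrans_def row_def sum_distrib_left mult.left_commute[of "weight s A"])
qed

text \<open>Reduction modulo \<open>y^4 + 1\<close> is done by its dual: a coefficient of the reduced polynomial is a linear
functional on Laurent polynomials, given by a function \<open>\<chi>\<close> on the exponents.\<close>

definition pairing :: "'a::field \<Rightarrow> (int \<Rightarrow> 'a) \<Rightarrow> nat \<Rightarrow> 'a" where
  "pairing s \<chi> m = Sum_any (\<lambda>A. \<chi> A * row s m A)"

lemma finite_support_row: "finite {A. f A * row s m (A + c) \<noteq> 0}"
proof (rule finite_subset)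
  show "{A. f A * row s m (A + c) \<noteq> 0} \<subseteq> {- int m - c..int m + 1 - c}"
    using row_eq_0[of "_ + c" m s] by force
qed simp

lemma pairing_eq_sum:
  assumes "int m \<le> K"
  shows "pairing s \<chi> m = (\<Sum>A = - K..K + 1. \<chi> A * row s m A)"
  unfolding pairing_def
proof (rule Sum_any.expand_superset)
  show "{A. \<chi> A * row s m A \<noteq> 0} \<subseteq> {- K..K + 1}"
    using row_eq_0[of _ m s] assms by force
qed simp

text \<open>Shifts of the row move to \<open>\<chi>\<close> by a change of the summation index, so that multiplication by
\<open>z = y + 1/y\<close> acts on \<open>\<chi>\<close> as the sum of both neighbours.\<close>

lemma pairing_Suc:
  assumes s: "generic s"
  shows "pairing s \<chi> (Suc m) = (1 + s ^ (2 * Suc m)) * pairing s \<chi> m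
     + s ^ Suc m * pairing s (\<lambda>A. \<chi> (A - 1) + \<chi> (A + 1)) m"
proof -
  have shift: "Sum_any (\<lambda>A. \<chi> A * row s m (A + c)) = Sum_any (\<lambda>A. \<chi> (A - c) * row s m A)" for c
    by (rule sym, rule Sum_any.reindex_cong[of "\<lambda>A. A + c"]) 
      (auto intro!: o_bij[of "\<lambda>A. A - c"])
  have fin: "finite {A. f A * row s m A \<noteq> 0}" for f
    using finite_support_row[of f s m 0] by simp
  have fin2: "finite {A. c * (f A * row s m (A + d)) \<noteq> 0}" for f c d
    using finite_support_row[of "\<lambda>A. c * f A" s m d] by (simp add: mult.assoc)
  have "pairing s \<chi> (Suc m) = Sum_any (\<lambda>A. (1 + s ^ (2 * Suc m)) * (\<chi> A * row s m (A + 0))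
     + (s ^ Suc m * (\<chi> A * row s m (A + 1)) + s ^ Suc m * (\<chi> A * row s m (A + - 1))))"
    unfolding pairing_def row_Suc[OF s] by (simp add: algebra_simps)
  also have "\<dots> = (1 + s ^ (2 * Suc m)) * pairing s \<chi> m
      + (s ^ Suc m * Sum_any (\<lambda>A. \<chi> A * row s m (A + 1)) + s ^ Suc m * Sum_any (\<lambda>A. \<chi> A * row s m (A + - 1)))"
    (is "?L = ?R")
  proof -
    have f: "finite {A. s ^ Suc m * (\<chi> A * row s m (A + 1)) + s ^ Suc m * (\<chi> A * row s m (A + - 1)) \<noteq> 0}"
      by (rule finite_subset[OF _ finite_UnI[OF fin2[of "s ^ Suc m" \<chi> 1] fin2[of "s ^ Suc m" \<chi> "- 1"]]]) auto
    have "?L = Sum_any (\<lambda>A. (1 + s ^ (2 * Suc m)) * (\<chi> A * row s m (A + 0)))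
      + (Sum_any (\<lambda>A. s ^ Suc m * (\<chi> A * row s m (A + 1))) + Sum_any (\<lambda>A. s ^ Suc m * (\<chi> A * row s m (A + - 1))))"
      by (subst Sum_any.distrib[OF fin2 f], subst Sum_any.distrib[OF fin2 fin2]) (rule refl)
    also have "\<dots> = ?R"
      by (simp only: Sum_any_right_distrib[OF finite_support_row, symmetric] pairing_def) simp
    finally show ?thesis .
  qed
  also have "Sum_any (\<lambda>A. \<chi> A * row s m (A + 1)) = Sum_any (\<lambda>A. \<chi> (A - 1) * row s m A)" by (rule shift)
  also have "Sum_any (\<lambda>A. \<chi> A * row s m (A + - 1)) = Sum_any (\<lambda>A. \<chi> (A + 1) * row s m A)"
    using shift[of "- 1"] by simp
  finally show ?thesis
    unfolding pairing_def by (simp add: ring_distribs Sum_any.distrib[OF fin fin])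
qed

lemma pairing_scale: "pairing s (\<lambda>A. c * \<chi> A) m = c * pairing s \<chi> m"
  using Sum_any_right_distrib[OF finite_support_row[of \<chi> s m 0], of c]
  by (simp add: pairing_def mult.assoc)

text \<open>The functional that takes the coefficient of \<open>y^2\<close> modulo \<open>y^4 + 1\<close>.\<close>

definition sgn4 :: "int \<Rightarrow> 'a::field" where
  "sgn4 A = (if A mod 4 = 2 then (- 1) powi (A div 4) else 0)"

lemma sgn4_add_4: "sgn4 (A + 4) = - sgn4 A"
proof -
  have "(A + 4) div 4 = A div 4 + 1" by simp
  then show ?thesis by (simp add: sgn4_def power_int_add)
qed

text \<open>The image of \<open>sgn4\<close> under the action of \<open>z\<close>.\<close>

definition sgn4' :: "int \<Rightarrow> 'a::field" where
  "sgn4' A = sgn4 (A - 1) + sgn4 (A + 1)"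

text \<open>The dual form of \<open>z^2 = 2\<close> modulo \<open>y^4 + 1\<close>: the contributions of \<open>y^2\<close> and \<open>y^{-2}\<close> cancel.\<close>

lemma sgn4'_neighbours: "sgn4' (A - 1) + sgn4' (A + 1) = (2 * sgn4 A :: 'a::field)"
proof -
  have "sgn4 (A + 2) = (- sgn4 (A - 2) :: 'a)"
    using sgn4_add_4[of "A - 2"] by (simp add: add.commute)
  then show ?thesis by (simp add: sgn4'_def add.commute)
qed

lemma pairing_sgn4_0: "pairing s sgn4 0 = 0"
  using pairing_eq_sum[of 0 0 s sgn4]
  by (simp add: sgn4_def simp_from_to)

lemma pairing_sgn4'_0: "generic s \<Longrightarrow> pairing s sgn4' 0 = 1"
  using pairing_eq_sum[of 0 0 s sgn4']
  by (simp add: sgn4'_def sgn4_def row_def weight_def gauss_0 gauss_self simp_from_to)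

definition bilateral_sum :: "'a::field \<Rightarrow> nat \<Rightarrow> 'a" where
  "bilateral_sum s n = Sum_any (\<lambda>j::int. (- 1) powi j * (s ^ 2) powi (4 * j ^ 2 + 3 * j) *
     V (n + 2) (4 * j + 2) s)"

lemma Sum_any_sgn4: "Sum_any (\<lambda>A. sgn4 A * g A) = Sum_any (\<lambda>j. (- 1) powi j * g (4 * j + 2))"
  for g :: "int \<Rightarrow> 'a::field"
proof -
  let ?h = "\<lambda>j::int. 4 * j + 2"
  have "{A. sgn4 A * g A \<noteq> 0} = ?h ` {j. (- 1) powi j * g (4 * j + 2) \<noteq> 0}"
  proof (intro equalityI subsetI)
    fix A assume A: "A \<in> {A. sgn4 A * g A \<noteq> 0}"
    then have "A mod 4 = 2" by (auto simp: sgn4_def split: if_splits)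
    then have "A = ?h (A div 4)" by presburger
    then show "A \<in> ?h ` {j. (- 1) powi j * g (4 * j + 2) \<noteq> 0}"
      using A by (intro image_eqI[of _ _ "A div 4"]) (auto simp: sgn4_def)
  qed (auto simp: sgn4_def)
  moreover have "inj_on ?h S" for S by (auto simp: inj_on_def)
  ultimately show ?thesis
    by (simp add: Sum_any.expand_set sum.reindex) (simp add: sgn4_def)
qed

text \<open>Interchanging the sum over \<open>r\<close> with the bilateral sum; the extra factor \<open>s\<close> comes from the weight.\<close>

lemma qtrans_pairing_eq_bilateral_sum:
  assumes s: "generic s"
  shows "qtrans s (pairing s sgn4) (n + 1) = s * bilateral_sum s n"
proof -
  let ?N = "n + 1"
  have s0: "s \<noteq> 0" using genericD(1)[OF s] .
  have sq: "s powi (2 * k) = (s ^ 2) powi k" for k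
    using power_int_mult[of s 2 k] by simp
  have "qtrans s (pairing s sgn4) ?N = (\<Sum>A = - int ?N..int ?N + 1. sgn4 A * qtrans s (\<lambda>m. row s m A) ?N)"
  proof -
    have "pairing s sgn4 (?N - r) = (\<Sum>A = - int ?N..int ?N + 1. sgn4 A * row s (?N - r) A)" for r
      by (rule pairing_eq_sum) simp
    then have "qtrans s (pairing s sgn4) ?N = (\<Sum>r\<le>?N. \<Sum>A = - int ?N..int ?N + 1.
        (- s) ^ r * gauss (s ^ 2) (int ?N) (int r) * (sgn4 A * row s (?N - r) A))"
      by (simp only: qtrans_def sum_distrib_left)
    also have "\<dots> = (\<Sum>A = - int ?N..int ?N + 1. sgn4 A * qtrans s (\<lambda>m. row s m A) ?N)"
      unfolding qtrans_def sum_distrib_left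
      by (subst sum.swap) (intro sum.cong refl, simp only: mult_ac)
    finally show ?thesis .
  qed
  also have "\<dots> = Sum_any (\<lambda>A. sgn4 A * qtrans s (\<lambda>m. row s m A) ?N)"
  proof (rule Sum_any.expand_superset[symmetric])
    have "qtrans s (\<lambda>m. row s m A) ?N = 0" if "A \<notin> {- int ?N..int ?N + 1}" for A
      unfolding qtrans_def by (rule sum.neutral) (use that in \<open>auto intro!: row_eq_0\<close>)
    then show "{A. sgn4 A * qtrans s (\<lambda>m. row s m A) ?N \<noteq> 0} \<subseteq> {- int ?N..int ?N + 1}"
      by force
  qed simp
  also have "\<dots> = Sum_any (\<lambda>j. (- 1) powi j * (weight s (4 * j + 2) * V (n + 2) (4 * j + 2) s))"
    unfolding V_eq_qtrans_row[OF s, symmetric] Sum_any_sgn4 by simp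
  also have "\<dots> = Sum_any (\<lambda>j. s * ((- 1) powi j * (s ^ 2) powi (4 * j ^ 2 + 3 * j) * V (n + 2) (4 * j + 2) s))"
  proof (rule Sum_any.cong)
    fix j :: int
    have "(4 * j + 2) * (4 * j + 2 - 1) = 2 * (1 + 2 * (4 * j ^ 2 + 3 * j))"
      by (simp add: algebra_simps power2_eq_square)
    then have "(4 * j + 2) * (4 * j + 2 - 1) div 2 = 1 + 2 * (4 * j ^ 2 + 3 * j)" by simp
    then have "weight s (4 * j + 2) = s * s powi (2 * (4 * j ^ 2 + 3 * j))"
      unfolding weight_def using power_int_add[of s 1 "2 * (4 * j ^ 2 + 3 * j)"] s0 by simp
    also have "s powi (2 * (4 * j ^ 2 + 3 * j)) = (s ^ 2) powi (4 * j ^ 2 + 3 * j)"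
      by (rule sq)
    finally show "(- 1) powi j * (weight s (4 * j + 2) * V (n + 2) (4 * j + 2) s)
        = s * ((- 1) powi j * (s ^ 2) powi (4 * j ^ 2 + 3 * j) * V (n + 2) (4 * j + 2) s)"
      by simp
  qed
  also have "\<dots> = s * bilateral_sum s n"
    unfolding bilateral_sum_def
    by (rule Sum_any_right_distrib[OF finite_support_V[where f = "\<lambda>j. (- 1) powi j * (s ^ 2) powi (4 * j ^ 2 + 3 * j)"], symmetric])
  finally show ?thesis .
qed

text \<open>The transform of \<open>b\<close> takes the values \<open>0\<close> and \<open>s\<close> at \<open>0\<close> and \<open>1\<close>, and its value at \<open>n + 1\<close> is \<open>s\<close> times the
bilateral sum. The value \<open>0\<close> is why the recurrence for \<open>n = 2\<close> has only two terms.\<close>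

lemma bilateral_sum_recurrence:
  assumes s: "generic s"
  shows "bilateral_sum s 0 = 1" "bilateral_sum s 1 = s ^ 4 + 1"
    "bilateral_sum s 2 = (1 + s ^ 6) * bilateral_sum s 1 + s ^ 2 * bilateral_sum s 0"
    "bilateral_sum s (n + 3) = (1 + s ^ (2 * (n + 4))) * bilateral_sum s (n + 2) + s ^ 2 * bilateral_sum s (n + 1)
       + (s ^ (2 * (n + 3)) - s ^ 2) * bilateral_sum s n"
proof -
  have s0: "s \<noteq> 0" using genericD(1)[OF s] .
  let ?b = "pairing s sgn4" and ?a = "pairing s sgn4'"
  let ?e = "qtrans s ?b"
  have b: "?b (Suc m) = (1 + s ^ (2 * Suc m)) * ?b m + s ^ Suc m * ?a m" for m
    using pairing_Suc[OF s, of sgn4 m] by (simp only: sgn4'_def[abs_def])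
  have a: "?a (Suc m) = (1 + s ^ (2 * Suc m)) * ?a m + 2 * s ^ Suc m * ?b m" for m
    using pairing_Suc[OF s, of sgn4' m] by (simp only: sgn4'_neighbours pairing_scale) (simp only: mult_ac)
  note rec = qtrans_recurrence[OF s b a]
  have e0: "?e 0 = 0" by (simp add: qtrans_0[OF s] pairing_sgn4_0)
  have e1: "?e 1 = s"
    using b[of 0] by (simp add: qtrans_Suc[OF s] qtrans_0[OF s] pairing_sgn4_0 pairing_sgn4'_0[OF s])
  have E: "?e (Suc k) = s * bilateral_sum s k" for k using qtrans_pairing_eq_bilateral_sum[OF s, of k] by simp
  show V0: "bilateral_sum s 0 = 1" using E[of 0] e1 s0 by simp
  have "?e (Suc 1) = (1 + s ^ 4) * ?e (Suc 0)"
    using rec[of 0] e0 by (simp add: eval_nat_numeral)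
  then show "bilateral_sum s 1 = s ^ 4 + 1"
    unfolding E V0 using s0 by (simp add: mult.commute add.commute)
  have "?e (Suc 2) = (1 + s ^ 6) * ?e (Suc 1) + s ^ 2 * ?e (Suc 0)"
    using rec[of 1] e0 by (simp add: eval_nat_numeral)
  then have "s * bilateral_sum s 2 = s * ((1 + s ^ 6) * bilateral_sum s 1 + s ^ 2 * bilateral_sum s 0)"
    unfolding E by (simp only: ring_distribs mult_ac)
  then show "bilateral_sum s 2 = (1 + s ^ 6) * bilateral_sum s 1 + s ^ 2 * bilateral_sum s 0"
    by (simp only: mult_left_cancel[OF s0])
  have "?e (Suc (n + 3)) = (1 + s ^ (2 * (n + 4))) * ?e (Suc (n + 2)) + s ^ 2 * ?e (Suc (n + 1))
       + (s ^ (2 * (n + 3)) - s ^ 2) * ?e (Suc n)"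
    using rec[of "n + 2"] by (simp add: eval_nat_numeral)
  then have "s * bilateral_sum s (n + 3) = s * ((1 + s ^ (2 * (n + 4))) * bilateral_sum s (n + 2) + s ^ 2 * bilateral_sum s (n + 1)
       + (s ^ (2 * (n + 3)) - s ^ 2) * bilateral_sum s n)"
    unfolding E by (simp add: algebra_simps)
  then show "bilateral_sum s (n + 3) = (1 + s ^ (2 * (n + 4))) * bilateral_sum s (n + 2) + s ^ 2 * bilateral_sum s (n + 1)
       + (s ^ (2 * (n + 3)) - s ^ 2) * bilateral_sum s n"
    by (simp only: mult_left_cancel[OF s0])
qed

section \<open>The triple sum\<close>

text \<open>The power series \<open>\<Sum>_k u(k) x^{2k}\<close>: both \<open>i\<close> and \<open>k\<close> enter the upper index \<open>n - 2i - 2k\<close> doubled.\<close>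

definition even_fps :: "(nat \<Rightarrow> 'a::comm_ring_1) \<Rightarrow> 'a fps" where
  "even_fps u = Abs_fps (\<lambda>n. if even n then u (n div 2) else 0)"

lemma even_fps_mult_nth:
  "(even_fps u * F) $ n = (\<Sum>k\<le>n. u k * (if 2 * k \<le> n then F $ (n - 2 * k) else 0))"
proof -
  have "(even_fps u * F) $ n = (\<Sum>m\<in>{0..n}. if even m then u (m div 2) * F $ (n - m) else 0)"
    unfolding fps_mult_nth even_fps_def by (intro sum.cong refl) simp
  also have "\<dots> = (\<Sum>m\<in>{m\<in>{0..n}. even m}. u (m div 2) * F $ (n - m))"
    by (rule sum.inter_filter[symmetric]) simp
  also have "\<dots> = (\<Sum>k\<in>{k\<in>{..n}. 2 * k \<le> n}. u k * F $ (n - 2 * k))"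
    by (rule sum.reindex_bij_witness[of _ "\<lambda>k. 2 * k" "\<lambda>m. m div 2"]) auto
  also have "\<dots> = (\<Sum>k\<le>n. if 2 * k \<le> n then u k * F $ (n - 2 * k) else 0)"
    by (rule sum.inter_filter) simp
  also have "\<dots> = (\<Sum>k\<le>n. u k * (if 2 * k \<le> n then F $ (n - 2 * k) else 0))"
    by (intro sum.cong refl) simp
  finally show ?thesis .
qed

text \<open>The numerator \<open>\<Prod>_{l<j} (1 + q^{2l+1} x^2)\<close>.\<close>

definition numerator_fps :: "'a::field \<Rightarrow> nat \<Rightarrow> 'a fps" where
  "numerator_fps q j = even_fps (\<lambda>i. q ^ (i ^ 2) * gauss (q ^ 2) (int j) (int i))"

text \<open>The reciprocal of \<open>\<Prod>_{l\<le>j} (1 - q^{2l+1} x^2)\<close>.\<close>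

definition denominator_fps :: "'a::field \<Rightarrow> nat \<Rightarrow> 'a fps" where
  "denominator_fps q j = even_fps (\<lambda>k. q ^ k * gauss (q ^ 2) (int j + int k) (int k))"

text \<open>The quotient \<open>x^j / \<Prod>_{l\<le>j} (1 - q^l x)\<close>.\<close>

definition gauss_column_fps :: "'a::field \<Rightarrow> nat \<Rightarrow> 'a fps" where
  "gauss_column_fps q j = Abs_fps (\<lambda>n. gauss q (int n) (int j))"

definition P_fps :: "'a::field \<Rightarrow> nat \<Rightarrow> 'a fps" where
  "P_fps q j = fps_const (q ^ (j * (j + 3) div 2)) * (numerator_fps q j * (denominator_fps q j * gauss_column_fps q j))"

abbreviation dilate :: "'a::field \<Rightarrow> 'a fps \<Rightarrow> 'a fps" where
  "dilate q F \<equiv> F oo (fps_const q * fps_X)"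

lemma P_fps_nth: "P_fps q j $ n = (\<Sum>i\<le>n. \<Sum>k\<le>n. Pterm q n i j k)"
proof -
  have "(denominator_fps q j * gauss_column_fps q j) $ m = (\<Sum>k\<le>M. q ^ k * gauss (q ^ 2) (int j + int k) (int k) *
      gauss q (int m - 2 * int k) (int j))" if "m \<le> M" for m M
  proof -
    have "(denominator_fps q j * gauss_column_fps q j) $ m = (\<Sum>k\<le>m. q ^ k * gauss (q ^ 2) (int j + int k) (int k) *
        gauss q (int m - 2 * int k) (int j))"
      unfolding denominator_fps_def even_fps_mult_nth
      by (intro sum.cong refl) (auto simp: gauss_column_fps_def gauss_eq_0 of_nat_diff)
    also have "\<dots> = (\<Sum>k\<le>M. q ^ k * gauss (q ^ 2) (int j + int k) (int k) *
        gauss q (int m - 2 * int k) (int j))"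
      by (rule sum.mono_neutral_left) (use that in \<open>auto simp: gauss_eq_0\<close>)
    finally show ?thesis .
  qed
  note B = this[of _ n]
  have H: "(numerator_fps q j * (denominator_fps q j * gauss_column_fps q j)) $ n =
    (\<Sum>i\<le>n. q ^ (i ^ 2) * gauss (q ^ 2) (int j) (int i) * (\<Sum>k\<le>n. q ^ k * gauss (q ^ 2) (int j + int k) (int k) *
      gauss q (int n - 2 * int i - 2 * int k) (int j)))"
    unfolding numerator_fps_def even_fps_mult_nth
    by (intro sum.cong refl) (auto simp: B of_nat_diff gauss_eq_0)
  show ?thesis
    unfolding P_fps_def fps_mult_left_const_nth H Pterm_def sum_distrib_left power_add
    by (simp only: mult_ac)
qed

lemma P_fps_nth_eq_0: "n < j \<Longrightarrow> P_fps q j $ n = 0"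
  unfolding P_fps_nth Pterm_def by (simp add: gauss_eq_0)

lemma Psum_eq_nth:
  assumes "n \<le> J"
  shows "Psum q n = (\<Sum>j\<le>J. P_fps q j) $ n"
proof -
  have "Psum q n = (\<Sum>j\<le>n. P_fps q j $ n)"
    unfolding Psum_eq_finite_sum P_fps_nth by (rule sum.swap)
  also have "\<dots> = (\<Sum>j\<le>J. P_fps q j $ n)"
    by (rule sum.mono_neutral_left) (use assms in \<open>auto simp: P_fps_nth_eq_0\<close>)
  finally show ?thesis by (simp add: fps_sum_nth)
qed

lemma X_power2_mult_nth: "(fps_X ^ 2 * F) $ n = (if n < 2 then 0 else F $ (n - 2))"
  by (simp add: fps_X_power_mult_nth)

lemma numerator_fps_Suc:
  assumes q: "generic q"
  shows "numerator_fps q (Suc j) = (1 + fps_const q * fps_X ^ 2) * dilate q (numerator_fps q j)"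
proof (rule fps_ext)
  fix n
  have Q: "generic (q ^ 2)" by (rule generic_power2[OF q])
  show "numerator_fps q (Suc j) $ n = ((1 + fps_const q * fps_X ^ 2) * dilate q (numerator_fps q j)) $ n"
  proof (cases "even n")
    case False
    then show ?thesis
      by (simp add: numerator_fps_def even_fps_def ring_distribs mult.assoc X_power2_mult_nth)
  next
    case True
    then obtain i where n: "n = 2 * i" by (auto elim: evenE)
    have z: "q ^ (l * 2) = q ^ l * q ^ l" for l
      by (simp only: power_mult power2_eq_square)
    have P: "gauss (q ^ 2) (int (Suc j)) (int i) =
      gauss (q ^ 2) (int j) (int i - 1) + (q ^ 2) ^ i * gauss (q ^ 2) (int j) (int i)"
      using gauss_Pascal[OF Q, of "int j" "int i"] by (simp add: add.commute)
    show ?thesis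
    proof (cases i)
      case 0
      then show ?thesis by (simp add: n numerator_fps_def even_fps_def gauss_0[OF Q])
    next
      case (Suc l)
      have "q ^ (i ^ 2) = q * (q ^ (2 * l) * q ^ (l ^ 2))"
      proof -
        have "i ^ 2 = Suc (2 * l + l ^ 2)" by (simp add: Suc power2_eq_square)
        then show ?thesis by (simp add: power_add)
      qed
      then show ?thesis
        unfolding ring_distribs mult.assoc fps_add_nth
        using P by (simp add: n Suc X_power2_mult_nth numerator_fps_def even_fps_def)
          (simp add: algebra_simps power2_eq_square power_add z)
    qed
  qed
qed

lemma denominator_fps_Suc:
  assumes q: "generic q"
  shows "(1 - fps_const q * fps_X ^ 2) * denominator_fps q (Suc j) = dilate q (denominator_fps q j)"
proof (rule fps_ext)
  fix n
  have Q: "generic (q ^ 2)" by (rule generic_power2[OF q])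
  show "((1 - fps_const q * fps_X ^ 2) * denominator_fps q (Suc j)) $ n = dilate q (denominator_fps q j) $ n"
  proof (cases "even n")
    case False
    then show ?thesis
      by (simp add: denominator_fps_def even_fps_def ring_distribs mult.assoc X_power2_mult_nth left_diff_distrib)
  next
    case True
    then obtain k where n: "n = 2 * k" by (auto elim: evenE)
    have z: "q ^ (l * 2) = q ^ l * q ^ l" for l
      by (simp only: power_mult power2_eq_square)
    have P: "gauss (q ^ 2) (int (Suc j) + int k) (int k) =
      gauss (q ^ 2) (int j + int k) (int k - 1) + (q ^ 2) ^ k * gauss (q ^ 2) (int j + int k) (int k)"
      using gauss_Pascal[OF Q, of "int j + int k" "int k"] by (simp add: add_ac)
    show ?thesis
    proof (cases k)
      case 0
      then show ?thesis by (simp add: n denominator_fps_def even_fps_def gauss_0[OF Q])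
    next
      case (Suc l)
      then show ?thesis
        unfolding left_diff_distrib mult.assoc fps_nth_compose_linear
        using P by (simp add: n X_power2_mult_nth denominator_fps_def even_fps_def)
          (simp add: algebra_simps power2_eq_square power_add z)
    qed
  qed
qed

lemma gauss_column_fps_Suc:
  assumes q: "generic q"
  shows "(1 - fps_X) * gauss_column_fps q (Suc j) = fps_const (1 / q ^ j) * (fps_X * dilate q (gauss_column_fps q j))"
proof (rule fps_ext)
  fix n
  show "((1 - fps_X) * gauss_column_fps q (Suc j)) $ n = (fps_const (1 / q ^ j) * (fps_X * dilate q (gauss_column_fps q j))) $ n"
  proof (cases n)
    case 0
    then show ?thesis by (simp add: gauss_column_fps_def left_diff_distrib gauss_eq_0)
  next
    case (Suc m)
    have "q powi (int m - int j) * gauss q (int m) (int j) = 1 / q ^ j * (q ^ m * gauss q (int m) (int j))"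
      using genericD(1)[OF q] by (simp add: power_int_diff)
    then show ?thesis
      using gauss_Pascal'[OF q, of "int m" "int (Suc j)"]
      by (simp add: Suc gauss_column_fps_def left_diff_distrib add.commute)
  qed
qed

lemma P_fps_0:
  assumes q: "generic q"
  shows "(1 - fps_X) * (1 - fps_const q * fps_X ^ 2) * P_fps q 0 = 1"
proof -
  have Q: "generic (q ^ 2)" by (rule generic_power2[OF q])
  have num: "numerator_fps q 0 = 1"
    by (rule fps_ext) (auto simp: numerator_fps_def even_fps_def gauss_0[OF Q] gauss_eq_0 elim!: evenE)
  have den: "(1 - fps_const q * fps_X ^ 2) * denominator_fps q 0 = 1"
  proof (rule fps_ext)
    fix n :: nat
    have d: "denominator_fps q 0 $ m = (if even m then q ^ (m div 2) else 0)" for m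
      by (simp add: denominator_fps_def even_fps_def gauss_self[OF Q])
    have "n = 0 \<or> n = 1 \<or> n = (n - 2) + 2" by arith
    then consider "n = 0" | "n = 1" | m where "n = m + 2" by blast
    then show "((1 - fps_const q * fps_X ^ 2) * denominator_fps q 0) $ n = 1 $ n"
      unfolding left_diff_distrib mult.assoc
      by cases (simp_all add: X_power2_mult_nth d)
  qed
  have row: "(1 - fps_X) * gauss_column_fps q 0 = 1"
    by (rule fps_ext) (simp add: gauss_column_fps_def left_diff_distrib gauss_0[OF q])
  have "(1 - fps_X) * (1 - fps_const q * fps_X ^ 2) * P_fps q 0 =
     ((1 - fps_const q * fps_X ^ 2) * denominator_fps q 0) * ((1 - fps_X) * gauss_column_fps q 0)"
  proof -
    have "P_fps q 0 = denominator_fps q 0 * gauss_column_fps q 0" by (simp add: P_fps_def num)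
    then show ?thesis by (simp only: mult_ac)
  qed
  then show ?thesis by (simp add: den row)
qed

text \<open>The three functional equations multiply to this one; the factor \<open>q^2\<close> is what remains of the
increment \<open>q^{j+2}\<close> of the prefactor after the division by \<open>q^j\<close>.\<close>

lemma P_fps_Suc:
  assumes q: "generic q"
  shows "(1 - fps_X) * (1 - fps_const q * fps_X ^ 2) * P_fps q (Suc j) =
     fps_const (q ^ 2) * fps_X * (1 + fps_const q * fps_X ^ 2) * dilate q (P_fps q j)"
proof -
  have X0: "(fps_const q * fps_X) $ 0 = 0" by simp
  let ?c = "\<lambda>j. fps_const (q ^ (j * (j + 3) div 2))"
  have "Suc j * (Suc j + 3) = j * (j + 3) + 2 * (j + 2)" by (simp add: algebra_simps)
  then have "Suc j * (Suc j + 3) div 2 = j * (j + 3) div 2 + (j + 2)" by simp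
  then have "q ^ (Suc j * (Suc j + 3) div 2) * (1 / q ^ j) = q ^ (j * (j + 3) div 2) * q ^ 2"
    using genericD(1)[OF q] by (simp add: power_add power2_eq_square)
  then have c: "?c (Suc j) * fps_const (1 / q ^ j) = ?c j * fps_const (q ^ 2)"
    by (simp only: fps_const_mult)
  have "(1 - fps_X) * (1 - fps_const q * fps_X ^ 2) * P_fps q (Suc j) =
     ?c (Suc j) * numerator_fps q (Suc j) * ((1 - fps_const q * fps_X ^ 2) * denominator_fps q (Suc j))
       * ((1 - fps_X) * gauss_column_fps q (Suc j))"
    by (simp only: P_fps_def mult_ac)
  also have "\<dots> = (?c (Suc j) * fps_const (1 / q ^ j)) * fps_X * (1 + fps_const q * fps_X ^ 2) *
      (dilate q (numerator_fps q j) * (dilate q (denominator_fps q j) * dilate q (gauss_column_fps q j)))"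
    unfolding numerator_fps_Suc[OF q] denominator_fps_Suc[OF q] gauss_column_fps_Suc[OF q] by (simp only: mult_ac)
  also have "dilate q (numerator_fps q j) * (dilate q (denominator_fps q j) * dilate q (gauss_column_fps q j))
      = dilate q (numerator_fps q j * (denominator_fps q j * gauss_column_fps q j))"
    by (simp only: fps_compose_mult_distrib[OF X0])
  also have "?c (Suc j) * fps_const (1 / q ^ j) * fps_X * (1 + fps_const q * fps_X ^ 2) * \<dots> =
      fps_const (q ^ 2) * fps_X * (1 + fps_const q * fps_X ^ 2) * dilate q (P_fps q j)"
    unfolding c P_fps_def fps_compose_mult_distrib[OF X0] fps_const_compose by (simp only: mult_ac)
  finally show ?thesis .
qed

lemma P_fps_sum:
  assumes q: "generic q"
  shows "(1 - fps_X) * (1 - fps_const q * fps_X ^ 2) * (\<Sum>j\<le>Suc J. P_fps q j) =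
     1 + fps_const (q ^ 2) * fps_X * (1 + fps_const q * fps_X ^ 2) * dilate q (\<Sum>j\<le>J. P_fps q j)"
  unfolding sum.atMost_Suc_shift
  by (simp add: distrib_left P_fps_0[OF q] sum_distrib_left P_fps_Suc[OF q] fps_compose_sum_distrib)

text \<open>Finitely many \<open>j\<close> suffice for any given coefficient, so the functional equation of a partial sum over
\<open>j\<close> is enough. In degree \<open>m\<close> it contains the dilated series only through the coefficients at \<open>m - 1\<close>
and \<open>m - 3\<close>, which become \<open>q^{m+1} P_{m-1}\<close> and \<open>q^m P_{m-3}\<close>.\<close>

lemma Psum_recurrence:
  assumes q: "generic q"
  shows "Psum q 0 = 1" "Psum q 1 = q ^ 2 + 1" "Psum q 2 = (1 + q ^ 3) * Psum q 1 + q * Psum q 0"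
    "Psum q (n + 3) = (1 + q ^ (n + 4)) * Psum q (n + 2) + q * Psum q (n + 1) + (q ^ (n + 3) - q) * Psum q n"
proof -
  let ?J = "n + 3"
  define F where "F = (\<Sum>j\<le>Suc ?J. P_fps q j)"
  define G where "G = (\<Sum>j\<le>?J. P_fps q j)"
  have F: "F $ m = Psum q m" if "m \<le> n + 3" for m using Psum_eq_nth[of m "Suc ?J" q] that by (simp add: F_def)
  have G: "G $ m = Psum q m" if "m \<le> n + 3" for m using Psum_eq_nth[of m ?J q] that by (simp add: G_def)
  have F1: "(1 - fps_X) * (1 - fps_const q * fps_X ^ 2) * F =
     1 + fps_const (q ^ 2) * fps_X * (1 + fps_const q * fps_X ^ 2) * dilate q G"
    unfolding F_def G_def by (rule P_fps_sum[OF q])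
  have E: "F - fps_X * F - fps_const q * (fps_X ^ 2 * F) + fps_const q * (fps_X ^ 3 * F) =
     1 + fps_const (q ^ 2) * (fps_X * dilate q G) + fps_const q * (fps_const (q ^ 2) * (fps_X ^ 3 * dilate q G))"
  proof -
    have "F - x * F - c * (x ^ 2 * F) + c * (x ^ 3 * F) = 1 + d * (x * H) + c * (d * (x ^ 3 * H))"
      if "(1 - x) * (1 - c * x ^ 2) * F = 1 + d * x * (1 + c * x ^ 2) * H" for x c d H :: "'a fps"
      using that by algebra
    then show ?thesis using F1 by blast
  qed
  have eq: "F $ m - (if m < 1 then 0 else F $ (m - 1)) - q * (if m < 2 then 0 else F $ (m - 2))
      + q * (if m < 3 then 0 else F $ (m - 3)) = (if m = 0 then 1 else 0)
      + q ^ 2 * (if m < 1 then 0 else q ^ (m - 1) * G $ (m - 1))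
      + q ^ 3 * (if m < 3 then 0 else q ^ (m - 3) * G $ (m - 3))" for m
  proof -
    have q3: "q ^ 3 = q * q ^ 2" by (simp add: power3_eq_cube power2_eq_square)
    show ?thesis
      using arg_cong[OF E, of "\<lambda>H. H $ m"]
      by (simp add: fps_X_power_mult_nth q3 mult.assoc)
  qed
  show "Psum q 0 = 1" using eq[of 0] by (simp add: F)
  show "Psum q 1 = q ^ 2 + 1" using eq[of 1] eq[of 0] by (simp add: F G algebra_simps)
  show "Psum q 2 = (1 + q ^ 3) * Psum q 1 + q * Psum q 0"
    using eq[of 2] by (simp add: F G algebra_simps eval_nat_numeral)
  show "Psum q (n + 3) = (1 + q ^ (n + 4)) * Psum q (n + 2) + q * Psum q (n + 1) + (q ^ (n + 3) - q) * Psum q n"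
    using eq[of "n + 3"] by (simp add: F G algebra_simps power_add power2_eq_square power4_eq_xxxx)
qed

section \<open>Comparison of the recurrences\<close>

lemma Psum_eq_bilateral_sum:
  assumes s: "generic s"
  shows "Psum (s ^ 2) n = bilateral_sum s n"
proof (induction n rule: less_induct)
  case (less n)
  note P = Psum_recurrence[OF generic_power2[OF s]] and V = bilateral_sum_recurrence[OF s]
  have "n = 0 \<or> n = 1 \<or> n = 2 \<or> n = (n - 3) + 3" by arith
  then consider "n = 0" | "n = 1" | "n = 2" | m where "n = m + 3" by blast
  then show ?case
  proof cases
    case 1 then show ?thesis using P(1) V(1) by simp
  next
    case 2 then show ?thesis using P(2) V(2) by (simp flip: power_mult)
  next
    case 3 then show ?thesis using P(1-3) V(1-3) by (simp flip: power_mult)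
  next
    case (4 m)
    then show ?thesis using P(4)[of m] V(4)[of m] less[of m] less[of "m + 1"] less[of "m + 2"]
      by (simp flip: power_mult)
  qed
qed

lemma sqrt_q_power: "sqrt_q ^ n = Fraction_Field.Fract (monom 1 n) 1"
  by (induction n) (simp_all add: sqrt_q_def One_fract_def monom_Suc mult.commute)

text \<open>An indeterminate is not a root of unity, for reasons of degree.\<close>

lemma generic_sqrt_q: "generic sqrt_q"
  unfolding generic_def
proof (intro conjI allI impI)
  show "sqrt_q \<noteq> 0" by (simp add: sqrt_q_def Zero_fract_def eq_fract)
  fix n :: nat
  assume "n > 0"
  then have "monom 1 n \<noteq> (1 :: rat poly)"
    by (metis degree_1 degree_monom_eq not_gr_zero zero_neq_one)
  then show "sqrt_q ^ n \<noteq> 1" by (simp add: sqrt_q_power One_fract_def eq_fract)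
qed

theorem mainTheorem12:
  shows "(\<forall>n::nat. Psum ind_q n =
            Sum_any (\<lambda>j::int. (- 1) powi j * ind_q powi (4 * j ^ 2 + 3 * j) *
              V (n + 2) (4 * j + 2) sqrt_q)) \<and>
         Psum ind_q 0 = 1 \<and>
         Psum ind_q 1 = ind_q ^ 2 + 1 \<and>
         Psum ind_q 2 = ind_q ^ 5 + ind_q ^ 3 + ind_q ^ 2 + ind_q + 1 \<and>
         (\<forall>n\<ge>3. Psum ind_q n =
            (1 + ind_q ^ (n + 1)) * Psum ind_q (n - 1) + ind_q * Psum ind_q (n - 2) +
            (ind_q ^ n - ind_q) * Psum ind_q (n - 3))"
proof (intro conjI allI impI)
  have q: "generic ind_q" unfolding ind_q_def by (rule generic_power2[OF generic_sqrt_q])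
  note P = Psum_recurrence[OF q]
  show "Psum ind_q n = Sum_any (\<lambda>j::int. (- 1) powi j * ind_q powi (4 * j ^ 2 + 3 * j) *
      V (n + 2) (4 * j + 2) sqrt_q)" for n
    using Psum_eq_bilateral_sum[OF generic_sqrt_q, of n] by (simp only: bilateral_sum_def ind_q_def)
  show "Psum ind_q 0 = 1" "Psum ind_q 1 = ind_q ^ 2 + 1" by (rule P)+
  show "Psum ind_q 2 = ind_q ^ 5 + ind_q ^ 3 + ind_q ^ 2 + ind_q + 1"
    unfolding P(3) unfolding P(1,2) by (simp add: algebra_simps eval_nat_numeral)
  fix n :: nat
  assume "n \<ge> 3"
  then obtain m where "n = m + 3" by (metis le_Suc_ex add.commute)
  then show "Psum ind_q n = (1 + ind_q ^ (n + 1)) * Psum ind_q (n - 1) + ind_q * Psum ind_q (n - 2) +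
      (ind_q ^ n - ind_q) * Psum ind_q (n - 3)"
    using P(4)[of m] by (simp add: add.commute)
qed

end
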